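(* Let $\Phi(z)=1+B_1z+B_2z^2+B_3z^3+\cdots$ be analytic and univalent in $\mathbb{D}=\{z\in\mathbb{C}:|z|<1\}$, such that $\Phi(\mathbb{D})$ is symmetric with respect to the real axis and starlike with respect to $\Phi(0)=1$, and $\Phi'(0)=B_1>0$. For $f(z)=z+\sum_{n\ge2}a_nz^n$ in the Ma--Minda convex class $\mathcal{C}(\Phi)$, let $f^{-1}(z)=z+\sum_{n\ge2}A_nz^n$ be the Taylor expansion at $0$ of its inverse. If $$4B_1>\max\left\{|B_1^2+B_2|,\ |2B_1^2-B_2|\right\},$$ then the sharp upper bounds on $|a_3|-|a_2|$ and on $|A_3|-|A_2|$ over $\mathcal{C}(\Phi)$ are the same, i.e. $$\max_{f\in\mathcal{C}(\Phi)}\left(|a_3|-|a_2|\right)=\max_{f\in\mathcal{C}(\Phi)}\left(|A_3|-|A_2|\right).$$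
   Context: $\mathcal{A}$ denotes the class of functions $f$ analytic in $\mathbb{D}$ with $f(0)=0$, $f'(0)=1$, i.e. $f(z)=z+\sum_{n\ge2}a_nz^n$. For analytic $g,h$ on $\mathbb{D}$, $g$ is subordinate to $h$, written $g\prec h$, if there is an analytic $\omega:\mathbb{D}\to\mathbb{D}$ with $\omega(0)=0$ such that $g(z)=h(\omega(z))$ for all $z\in\mathbb{D}$. For $\Phi$ as in the statement, the Ma--Minda convex class $\mathcal{C}(\Phi)$ is the set of all $f\in\mathcal{A}$ such that $1+\dfrac{zf''(z)}{f'(z)}\prec\Phi(z)$ in $\mathbb{D}$. The inverse $f^{-1}$ is the inverse of $f$ near the origin, satisfying $f(f^{-1}(z))=z$ near $0$; its initial coefficients are $A_2=-a_2$ and $A_3=2a_2^2-a_3$. *)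

theory Defs
  imports "HOL-Complex_Analysis.Complex_Analysis"
begin

abbreviation unit_disc :: "complex set" where
  "unit_disc \<equiv> ball 0 1"

abbreviation taylor_coeff :: "(complex \<Rightarrow> complex) \<Rightarrow> nat \<Rightarrow> complex" where
  "taylor_coeff f n \<equiv> fps_nth (fps_expansion f 0) n"

definition class_A :: "(complex \<Rightarrow> complex) set" where
  "class_A = {f. f holomorphic_on unit_disc \<and> f 0 = 0 \<and> deriv f 0 = 1}"

definition subordinate :: "(complex \<Rightarrow> complex) \<Rightarrow> (complex \<Rightarrow> complex) \<Rightarrow> bool" where
  "subordinate g h \<longleftrightarrow>
     g holomorphic_on unit_disc \<and> h holomorphic_on unit_disc \<and>
     (\<exists>\<omega>. \<omega> holomorphic_on unit_disc \<and> \<omega> ` unit_disc \<subseteq> unit_disc \<and> \<omega> 0 = 0 \<and>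
          (\<forall>z\<in>unit_disc. g z = h (\<omega> z)))"

text \<open>
  The condition that \<open>f'\<close> has no zeros makes explicit that the quotient below is a genuine
  analytic function, independently of the convention \<open>x / 0 = 0\<close>.
\<close>

definition ma_minda_convex :: "(complex \<Rightarrow> complex) \<Rightarrow> (complex \<Rightarrow> complex) set" where
  "ma_minda_convex \<Phi> =
     {f \<in> class_A. (\<forall>z\<in>unit_disc. deriv f z \<noteq> 0) \<and>
        subordinate (\<lambda>z. 1 + z * deriv (deriv f) z / deriv f z) \<Phi>}"

definition is_local_inverse :: "(complex \<Rightarrow> complex) \<Rightarrow> (complex \<Rightarrow> complex) \<Rightarrow> bool" where
  "is_local_inverse f g \<longleftrightarrow>
     g analytic_on {0} \<and> g 0 = 0 \<and> (\<forall>\<^sub>F z in nhds 0. f (g z) = z)"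

text \<open>
  For \<open>f\<close> in \<open>class_A\<close> a local inverse exists and its germ at \<open>0\<close> is unique, so the
  Taylor coefficients of the chosen representative do not depend on the choice.
\<close>

definition local_inverse :: "(complex \<Rightarrow> complex) \<Rightarrow> (complex \<Rightarrow> complex)" where
  "local_inverse f = (SOME g. is_local_inverse f g)"

definition is_maximum :: "real \<Rightarrow> real set \<Rightarrow> bool" where
  "is_maximum m S \<longleftrightarrow> m \<in> S \<and> (\<forall>x\<in>S. x \<le> m)"

end

theory Submission
  imports Defs
begin

text \<open>
  Let \<open>f\<close> be in \<open>\<C>(\<Phi>)\<close> with Schwarz function \<open>\<omega>(z) = c\<^sub>1z + c\<^sub>2z\<^sup>2 + \<dots>\<close>. Comparing coefficients
  in \<open>z f'' = f' (\<Phi> \<circ> \<omega> - 1)\<close> gives \<open>2a\<^sub>2 = B\<^sub>1c\<^sub>1\<close> and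
  \<open>6a\<^sub>3 = B\<^sub>1c\<^sub>2 + (B\<^sub>1\<^sup>2 + B\<^sub>2)c\<^sub>1\<^sup>2\<close> (lemma \<open>ma_minda_convex_coeffs\<close>), and inverting the series
  gives \<open>6A\<^sub>3 = -B\<^sub>1c\<^sub>2 + (2B\<^sub>1\<^sup>2 - B\<^sub>2)c\<^sub>1\<^sup>2\<close> with \<open>|A\<^sub>2| = |a\<^sub>2|\<close>. Thus \<open>6a\<^sub>3\<close> and
  \<open>-6A\<^sub>3\<close> both have the form \<open>B\<^sub>1c\<^sub>2 + Kc\<^sub>1\<^sup>2\<close>, and the hypothesis says \<open>|K| < 4B\<^sub>1\<close> for both
  values of \<open>K\<close>.

  By the Schwarz--Pick inequality \<open>|c\<^sub>2| \<le> 1 - |c\<^sub>1|\<^sup>2\<close>, so with \<open>x = |c\<^sub>1| \<le> 1\<close> the difference of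
  moduli is at most \<open>(B\<^sub>1(1 - x\<^sup>2) + |K|x\<^sup>2)/6 - B\<^sub>1x/2 \<le> B\<^sub>1/6 + B\<^sub>1(x\<^sup>2 - x)/2 \<le> B\<^sub>1/6\<close>.
  For \<open>\<omega>(z) = z\<^sup>2\<close>, where \<open>c\<^sub>1 = 0\<close> and \<open>c\<^sub>2 = 1\<close>, the value \<open>B\<^sub>1/6\<close> is attained in both problems.
  The common maximum is therefore \<open>B\<^sub>1/6\<close>. The extremal function is obtained by solving
  \<open>1 + z f''/f' = \<Phi>(z\<^sup>2)\<close> with two successive primitives (lemma \<open>ma_minda_convex_exists\<close>).
\<close>

section \<open>Low-order coefficients of composed power series\<close>

lemma fps_compose_nth_low:
  fixes F G :: "'a :: comm_ring_1 fps"
  assumes "fps_nth G 0 = 0"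
  shows "fps_nth (F oo G) 1 = fps_nth F 1 * fps_nth G 1"
    and "fps_nth (F oo G) 2 = fps_nth F 1 * fps_nth G 2 + fps_nth F 2 * (fps_nth G 1)\<^sup>2"
    and "fps_nth (F oo G) 3 = fps_nth F 1 * fps_nth G 3
           + 2 * fps_nth F 2 * fps_nth G 1 * fps_nth G 2 + fps_nth F 3 * fps_nth G 1 ^ 3"
  using assms
  by (simp_all add: fps_compose_nth fps_mult_nth eval_nat_numeral algebra_simps)

lemma holomorphic_has_fps_expansion:
  assumes "f holomorphic_on unit_disc"
  shows "f has_fps_expansion fps_expansion f 0"
  using assms by (intro has_fps_expansion_fps_expansion[of unit_disc]) auto

lemma taylor_coeff_0:
  assumes "f has_fps_expansion F"
  shows "fps_nth F 0 = f 0"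
  using has_fps_expansion_imp_0_eq_fps_nth_0[OF assms] by simp

lemma taylor_coeff_1:
  assumes "f has_fps_expansion F"
  shows "fps_nth F 1 = deriv f 0"
  using taylor_coeff_0[OF has_fps_expansion_deriv[OF assms]] by simp

section \<open>The first two coefficients of a Schwarz function\<close>

text \<open>
  Write \<open>\<omega>(z) = z h(z)\<close>. Unless \<open>\<omega>\<close> is a rotation, \<open>h\<close> maps the disc into itself, and the Schwarz
  lemma for \<open>h\<close> followed by the disc automorphism that sends \<open>h(0)\<close> to \<open>0\<close> is the Schwarz--Pick
  inequality \<open>|h'(0)| \<le> 1 - |h(0)|\<^sup>2\<close>.
\<close>

lemma schwarz_function_coeff_bound:
  assumes hol: "\<omega> holomorphic_on unit_disc"
    and im: "\<omega> ` unit_disc \<subseteq> unit_disc"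
    and zero: "\<omega> 0 = 0"
  shows "cmod (taylor_coeff \<omega> 1) \<le> 1"
    and "cmod (taylor_coeff \<omega> 2) \<le> 1 - (cmod (taylor_coeff \<omega> 1))\<^sup>2"
proof -
  have no: "cmod (\<omega> z) < 1" if "cmod z < 1" for z
    using im that by (auto simp: image_subset_iff)
  note schwarz = Schwarz_Lemma[OF hol zero no]
  note exp = holomorphic_has_fps_expansion[OF hol]
  have c1: "taylor_coeff \<omega> 1 = deriv \<omega> 0"
    by (rule taylor_coeff_1[OF exp])
  show "cmod (taylor_coeff \<omega> 1) \<le> 1"
    unfolding c1 using schwarz(2)[of 0] by simp
  obtain h where holh: "h holomorphic_on unit_disc"
    and wh: "\<And>z. cmod z < 1 \<Longrightarrow> \<omega> z = z * h z" and h0: "deriv \<omega> 0 = h 0"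
    using Schwarz3[OF hol zero] by blast
  note exph = holomorphic_has_fps_expansion[OF holh]
  have "eventually (\<lambda>z. z \<in> unit_disc) (nhds (0::complex))"
    by (intro eventually_nhds_in_open) auto
  hence "eventually (\<lambda>z. \<omega> z = z * h z) (nhds 0)"
    by eventually_elim (auto intro: wh)
  moreover have "(\<lambda>z. z * h z) has_fps_expansion fps_X * fps_expansion h 0"
    by (intro fps_expansion_intros exph)
  ultimately have "\<omega> has_fps_expansion fps_X * fps_expansion h 0"
    by (simp add: has_fps_expansion_cong)
  hence "fps_expansion \<omega> 0 = fps_X * fps_expansion h 0"
    by (rule fps_expansion_eqI)
  hence c2: "taylor_coeff \<omega> 2 = deriv h 0"
    using taylor_coeff_1[OF exph] by simp
  show "cmod (taylor_coeff \<omega> 2) \<le> 1 - (cmod (taylor_coeff \<omega> 1))\<^sup>2"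
  proof (cases "\<exists>\<alpha>. (\<forall>z. cmod z < 1 \<longrightarrow> \<omega> z = \<alpha> * z) \<and> cmod \<alpha> = 1")
    case True
    then obtain \<alpha> where \<alpha>: "\<And>z. cmod z < 1 \<Longrightarrow> \<omega> z = \<alpha> * z" "cmod \<alpha> = 1"
      by blast
    have "eventually (\<lambda>z. \<omega> z = \<alpha> * z) (nhds 0)"
      using \<open>eventually (\<lambda>z. z \<in> unit_disc) (nhds 0)\<close> by eventually_elim (auto intro: \<alpha>)
    moreover have "(\<lambda>z. \<alpha> * z) has_fps_expansion fps_const \<alpha> * fps_X"
      by (intro fps_expansion_intros)
    ultimately have "\<omega> has_fps_expansion fps_const \<alpha> * fps_X"
      by (simp add: has_fps_expansion_cong)
    hence "fps_expansion \<omega> 0 = fps_const \<alpha> * fps_X"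
      by (rule fps_expansion_eqI)
    thus ?thesis
      using \<alpha>(2) by simp
  next
    case False
    have d1: "cmod (deriv \<omega> 0) < 1"
      using schwarz(2,3)[of 0] False by fastforce
    have hlt: "cmod (h z) < 1" if z: "cmod z < 1" for z
    proof (cases "z = 0")
      case True
      thus ?thesis using d1 h0 by simp
    next
      case z0: False
      have "cmod (\<omega> z) \<noteq> cmod z"
        using schwarz(3)[of z] z z0 False by blast
      with schwarz(1)[of z] z have "cmod (\<omega> z) < cmod z"
        by fastforce
      thus ?thesis
        using wh[OF z] z0 by (simp add: norm_mult)
    qed
    define a where "a = h 0"
    have a1: "cmod a < 1"
      using hlt[of 0] by (simp add: a_def)
    define g where "g = (\<lambda>z. Moebius_function 0 a (h z))"
    have "(Moebius_function 0 a \<circ> h) holomorphic_on unit_disc"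
      by (rule holomorphic_on_compose_gen[OF holh Moebius_function_holomorphic[OF a1]])
         (auto simp: hlt)
    hence "g holomorphic_on unit_disc"
      by (simp add: g_def o_def)
    moreover have "g 0 = 0"
      by (simp add: g_def a_def Moebius_function_eq_zero)
    moreover have "cmod (g z) < 1" if "cmod z < 1" for z
      using Moebius_function_norm_lt_1[OF a1 hlt[OF that]] by (simp add: g_def)
    ultimately have g': "cmod (deriv g 0) \<le> 1"
      by (intro Schwarz_Lemma(2)[where \<xi> = 0]) auto
    have pos: "0 < 1 - (cmod a)\<^sup>2"
      using a1 by (simp add: power_less_one_iff abs_square_less_1)
    have aa: "1 - cnj a * a = of_real (1 - (cmod a)\<^sup>2)"
      by (simp only: mult.commute[of "cnj a"] complex_norm_square[symmetric] of_real_diff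
          of_real_1 of_real_power)
    with pos have nz: "1 - cnj a * a \<noteq> 0"
      by (metis less_irrefl of_real_eq_0_iff)
    have dh: "(h has_field_derivative deriv h 0) (at 0)"
      using holh by (intro holomorphic_derivI[of _ unit_disc]) auto
    have "(g has_field_derivative
            (deriv h 0 * (1 - cnj a * h 0) - (h 0 - a) * (- (cnj a * deriv h 0)))
              / ((1 - cnj a * h 0) * (1 - cnj a * h 0))) (at 0)"
      unfolding g_def Moebius_function_simple
      using nz by (auto intro!: derivative_eq_intros dh simp: a_def)
    hence "deriv g 0 = deriv h 0 / (1 - cnj a * a)"
      using nz by (simp add: DERIV_imp_deriv a_def)
    hence "cmod (deriv g 0) = cmod (deriv h 0) / (1 - (cmod a)\<^sup>2)"
      using pos by (simp only: aa norm_divide norm_of_real)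
    with g' pos have "cmod (deriv h 0) \<le> 1 - (cmod a)\<^sup>2"
      by (simp add: field_simps)
    thus ?thesis
      by (simp only: c1 c2 h0 a_def)
  qed
qed

section \<open>Coefficients of convex functions and of their inverses\<close>

lemma class_A_fps_expansion:
  assumes "f \<in> class_A"
  shows "f has_fps_expansion fps_expansion f 0"
    and "taylor_coeff f 0 = 0" and "taylor_coeff f 1 = 1"
proof -
  show exp: "f has_fps_expansion fps_expansion f 0"
    using assms by (intro holomorphic_has_fps_expansion) (simp add: class_A_def)
  show "taylor_coeff f 0 = 0" "taylor_coeff f 1 = 1"
    using taylor_coeff_0[OF exp] taylor_coeff_1[OF exp] assms by (simp_all add: class_A_def)
qed

text \<open>
  Multiplying by \<open>f'\<close> turns the defining relation into an identity between power series without
  division, \<open>X F'' = F' ((\<Phi> \<circ> \<omega>) - 1)\<close>, whose coefficients of \<open>z\<close> and \<open>z\<^sup>2\<close> are compared.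
\<close>

lemma ma_minda_convex_coeffs:
  assumes f: "f \<in> class_A"
    and nz: "\<forall>z\<in>unit_disc. deriv f z \<noteq> 0"
    and \<Phi>: "\<Phi> holomorphic_on unit_disc" "\<Phi> 0 = 1"
    and \<omega>: "\<omega> holomorphic_on unit_disc" "\<omega> 0 = 0"
    and eq: "\<forall>z\<in>unit_disc. 1 + z * deriv (deriv f) z / deriv f z = \<Phi> (\<omega> z)"
  shows "2 * taylor_coeff f 2 = taylor_coeff \<Phi> 1 * taylor_coeff \<omega> 1"
    and "6 * taylor_coeff f 3 = taylor_coeff \<Phi> 1 * taylor_coeff \<omega> 2
           + ((taylor_coeff \<Phi> 1)\<^sup>2 + taylor_coeff \<Phi> 2) * (taylor_coeff \<omega> 1)\<^sup>2"
proof -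
  define F P W where "F = fps_expansion f 0" and "P = fps_expansion \<Phi> 0"
    and "W = fps_expansion \<omega> 0"
  note defs = F_def P_def W_def
  have F: "f has_fps_expansion F" "fps_nth F 0 = 0" "fps_nth F 1 = 1"
    using class_A_fps_expansion[OF f] by (simp_all add: F_def)
  have P: "\<Phi> has_fps_expansion P"
    unfolding P_def by (rule holomorphic_has_fps_expansion[OF \<Phi>(1)])
  have W: "\<omega> has_fps_expansion W"
    unfolding W_def by (rule holomorphic_has_fps_expansion[OF \<omega>(1)])
  have P0: "fps_nth P 0 = 1" and W0: "fps_nth W 0 = 0"
    using taylor_coeff_0[OF P] taylor_coeff_0[OF W] \<Phi>(2) \<omega>(2) by simp_all
  have "eventually (\<lambda>z. z \<in> unit_disc) (nhds (0::complex))"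
    by (intro eventually_nhds_in_open) auto
  hence ev: "eventually (\<lambda>z. z * deriv (deriv f) z = deriv f z * ((\<Phi> \<circ> \<omega>) z - 1)) (nhds 0)"
  proof eventually_elim
    case (elim z)
    with bspec[OF eq elim] bspec[OF nz elim] show ?case
      by (simp add: field_simps)
  qed
  have "(\<lambda>z. z * deriv (deriv f) z) has_fps_expansion fps_X * fps_deriv (fps_deriv F)"
    by (intro fps_expansion_intros F)
  hence "(\<lambda>z. deriv f z * ((\<Phi> \<circ> \<omega>) z - 1)) has_fps_expansion fps_X * fps_deriv (fps_deriv F)"
    using has_fps_expansion_cong[OF ev refl] by simp
  moreover have "(\<lambda>z. deriv f z * ((\<Phi> \<circ> \<omega>) z - 1)) has_fps_expansion
      fps_deriv F * ((P oo W) - 1)"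
    by (intro fps_expansion_intros F P W W0)
  ultimately have id: "fps_X * fps_deriv (fps_deriv F) = fps_deriv F * ((P oo W) - 1)"
    by (rule fps_expansion_unique_complex)
  note low = fps_compose_nth_low[OF W0, of P]
  have F1: "fps_nth F (Suc 0) = 1"
    using F(3) by simp
  have "fps_nth (fps_X * fps_deriv (fps_deriv F)) 1 = 2 * fps_nth F 2"
    by (simp add: numeral_2_eq_2)
  moreover have "fps_nth (fps_deriv F * ((P oo W) - 1)) 1 = fps_nth P 1 * fps_nth W 1"
    unfolding fps_mult_nth_1 using low(1) P0 F1 by simp
  ultimately have 1: "2 * fps_nth F 2 = fps_nth P 1 * fps_nth W 1"
    using id by simp
  thus "2 * taylor_coeff f 2 = taylor_coeff \<Phi> 1 * taylor_coeff \<omega> 1"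
    by (simp add: defs)
  have "fps_nth (fps_X * fps_deriv (fps_deriv F)) 2 = 6 * fps_nth F 3"
    by (simp add: eval_nat_numeral)
  moreover have "fps_nth (fps_deriv F * ((P oo W) - 1)) 2 =
      fps_nth (P oo W) 2 + (2 * fps_nth F 2) * fps_nth (P oo W) 1"
    using P0 F1 by (simp add: fps_mult_nth eval_nat_numeral)
  ultimately have "6 * fps_nth F 3 =
      fps_nth (P oo W) 2 + (2 * fps_nth F 2) * fps_nth (P oo W) 1"
    using id by simp
  also have "\<dots> = fps_nth P 1 * fps_nth W 2 + ((fps_nth P 1)\<^sup>2 + fps_nth P 2) * (fps_nth W 1)\<^sup>2"
    unfolding low 1 by (simp add: algebra_simps power2_eq_square)
  finally show "6 * taylor_coeff f 3 = taylor_coeff \<Phi> 1 * taylor_coeff \<omega> 2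
      + ((taylor_coeff \<Phi> 1)\<^sup>2 + taylor_coeff \<Phi> 2) * (taylor_coeff \<omega> 1)\<^sup>2"
    by (simp add: defs)
qed

lemma is_local_inverse_local_inverse:
  assumes f: "f \<in> class_A"
  shows "is_local_inverse f (local_inverse f)"
proof -
  have hol: "f holomorphic_on unit_disc" and f0: "f 0 = 0" and d: "deriv f 0 \<noteq> 0"
    using f by (auto simp: class_A_def)
  obtain r where r: "r > 0" "ball 0 r \<subseteq> unit_disc" "open (f ` ball 0 r)" "inj_on f (ball 0 r)"
    using has_complex_derivative_locally_invertible[OF hol, of 0] d by auto
  have holr: "f holomorphic_on ball 0 r"
    using hol r(2) by (rule holomorphic_on_subset)
  obtain g where g: "g holomorphic_on f ` ball 0 r" "\<And>z. z \<in> ball 0 r \<Longrightarrow> g (f z) = z"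
    using holomorphic_has_inverse[OF holr open_ball r(4)] by metis
  have mem: "0 \<in> f ` ball 0 r"
    using f0 r(1) by (metis centre_in_ball image_eqI)
  have "is_local_inverse f g"
    unfolding is_local_inverse_def
  proof (intro conjI)
    show "g analytic_on {0}"
      using g(1) r(3) mem analytic_at by blast
    show "g 0 = 0"
      using g(2)[of 0] f0 r(1) by simp
    have "eventually (\<lambda>z. z \<in> f ` ball 0 r) (nhds 0)"
      by (rule eventually_nhds_in_open[OF r(3) mem])
    thus "\<forall>\<^sub>F z in nhds 0. f (g z) = z"
      by eventually_elim (use g(2) in auto)
  qed
  thus ?thesis
    unfolding local_inverse_def by (rule someI[of "is_local_inverse f"])
qed

lemma local_inverse_coeffs:
  assumes f: "f \<in> class_A"
  shows "taylor_coeff (local_inverse f) 2 = - taylor_coeff f 2"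
    and "taylor_coeff (local_inverse f) 3 = 2 * (taylor_coeff f 2)\<^sup>2 - taylor_coeff f 3"
proof -
  define g where "g = local_inverse f"
  define F G where "F = fps_expansion f 0" and "G = fps_expansion g 0"
  have g: "g analytic_on {0}" "g 0 = 0" "\<forall>\<^sub>F z in nhds 0. f (g z) = z"
    using is_local_inverse_local_inverse[OF f] by (simp_all add: is_local_inverse_def g_def)
  have F: "f has_fps_expansion F" "fps_nth F 1 = 1"
    using class_A_fps_expansion[OF f] by (simp_all add: F_def)
  have G: "g has_fps_expansion G"
    unfolding G_def by (rule analytic_at_imp_has_fps_expansion_0[OF g(1)])
  have G0: "fps_nth G 0 = 0"
    using taylor_coeff_0[OF G] g(2) by simp
  have "(f \<circ> g) has_fps_expansion (F oo G)"
    by (rule has_fps_expansion_compose[OF F(1) G G0])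
  moreover have "\<forall>\<^sub>F z in nhds 0. (f \<circ> g) z = z"
    using g(3) by simp
  ultimately have "(\<lambda>z. z) has_fps_expansion (F oo G)"
    using has_fps_expansion_cong[of "f \<circ> g" "\<lambda>z. z", OF _ refl] by blast
  hence FG: "F oo G = fps_X"
    using has_fps_expansion_fps_X by (rule fps_expansion_unique_complex)
  note low = fps_compose_nth_low[OF G0, of F, unfolded FG F(2)]
  have G1: "fps_nth G 1 = 1"
    using low(1) by simp
  have "0 = fps_nth G 2 + fps_nth F 2"
    using low(2) unfolding G1 by simp
  hence G2: "fps_nth G 2 = - fps_nth F 2"
    by (simp add: eq_neg_iff_add_eq_0)
  have "0 = fps_nth G 3 + 2 * fps_nth F 2 * fps_nth G 2 + fps_nth F 3"
    using low(3) unfolding G1 by simp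
  hence "fps_nth G 3 = 2 * (fps_nth F 2)\<^sup>2 - fps_nth F 3"
    unfolding G2 by (simp add: algebra_simps power2_eq_square)
  with G2 show "taylor_coeff (local_inverse f) 2 = - taylor_coeff f 2"
      "taylor_coeff (local_inverse f) 3 = 2 * (taylor_coeff f 2)\<^sup>2 - taylor_coeff f 3"
    by (simp_all add: F_def G_def g_def)
qed

section \<open>Existence of a convex function with given Schwarz function\<close>

text \<open>
  The quotient \<open>q(z) = (\<Phi>(\<omega>(z)) - 1)/z\<close> has a removable singularity at \<open>0\<close>. It has to be the
  logarithmic derivative of \<open>f'\<close>, so \<open>f'\<close> is the exponential of a primitive of \<open>q\<close>, and \<open>f\<close> is
  a primitive of that; on the disc both primitives exist.
\<close>

lemma ma_minda_convex_exists:
  assumes \<Phi>: "\<Phi> holomorphic_on unit_disc" "\<Phi> 0 = 1"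
    and \<omega>: "\<omega> holomorphic_on unit_disc" "\<omega> ` unit_disc \<subseteq> unit_disc" "\<omega> 0 = 0"
  obtains f where "f \<in> ma_minda_convex \<Phi>"
    and "\<forall>z\<in>unit_disc. 1 + z * deriv (deriv f) z / deriv f z = \<Phi> (\<omega> z)"
proof -
  have hol: "(\<Phi> \<circ> \<omega>) holomorphic_on unit_disc"
    using \<Phi>(1) \<omega>(1,2) by (intro holomorphic_on_compose_gen)
  have "(\<lambda>z. (\<Phi> \<circ> \<omega>) z - 1) holomorphic_on unit_disc"
    by (intro holomorphic_intros hol)
  moreover have "(\<Phi> \<circ> \<omega>) 0 - 1 = 0"
    using \<Phi>(2) \<omega>(3) by simp
  ultimately obtain q where q: "q holomorphic_on unit_disc"
      "\<And>z. cmod z < 1 \<Longrightarrow> (\<Phi> \<circ> \<omega>) z - 1 = z * q z"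
    by (rule Schwarz3) auto
  obtain Q0 where "\<And>z. z \<in> unit_disc \<Longrightarrow> (Q0 has_field_derivative q z) (at z within unit_disc)"
    using holomorphic_convex_primitive'[OF convex_ball open_ball q(1)] by blast
  hence Q0: "(Q0 has_field_derivative q z) (at z)" if "z \<in> unit_disc" for z
    using that by (metis at_within_open open_ball)
  define p where "p = (\<lambda>z. exp (Q0 z - Q0 0))"
  have p': "(p has_field_derivative q z * p z) (at z)" if "z \<in> unit_disc" for z
    unfolding p_def by (auto intro!: derivative_eq_intros Q0 that)
  have p0: "p 0 = 1" and pnz: "p z \<noteq> 0" for z
    by (simp_all add: p_def)
  have holp: "p holomorphic_on unit_disc"
    unfolding holomorphic_on_open[OF open_ball] using p' by blast
  obtain f0 where "\<And>z. z \<in> unit_disc \<Longrightarrow> (f0 has_field_derivative p z) (at z within unit_disc)"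
    using holomorphic_convex_primitive'[OF convex_ball open_ball holp] by blast
  hence f0: "(f0 has_field_derivative p z) (at z)" if "z \<in> unit_disc" for z
    using that by (metis at_within_open open_ball)
  define f where "f = (\<lambda>z. f0 z - f0 0)"
  have f': "(f has_field_derivative p z) (at z)" if "z \<in> unit_disc" for z
    unfolding f_def by (auto intro!: derivative_eq_intros f0 that)
  have df: "deriv f z = p z" if "z \<in> unit_disc" for z
    by (rule DERIV_imp_deriv[OF f'[OF that]])
  have ddf: "deriv (deriv f) z = q z * p z" if "z \<in> unit_disc" for z
  proof -
    have "(deriv f has_field_derivative q z * p z) (at z)"
      using p'[OF that] open_ball that
      by (rule has_field_derivative_transform_within_open) (simp add: df)
    thus ?thesis
      by (rule DERIV_imp_deriv)
  qed
  have eq: "1 + z * deriv (deriv f) z / deriv f z = \<Phi> (\<omega> z)" if "z \<in> unit_disc" for z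
    using q(2)[of z] that pnz[of z] by (simp add: df ddf algebra_simps)
  have "f holomorphic_on unit_disc"
    unfolding holomorphic_on_open[OF open_ball] using f' by blast
  moreover have "f 0 = 0"
    by (simp add: f_def)
  moreover have "(\<lambda>z. 1 + z * deriv (deriv f) z / deriv f z) holomorphic_on unit_disc"
    using hol by (rule holomorphic_transform) (simp add: eq)
  ultimately have "f \<in> ma_minda_convex \<Phi>"
    unfolding ma_minda_convex_def class_A_def subordinate_def
    using df p0 pnz \<Phi>(1) \<omega> eq by auto
  thus thesis
    using eq that by blast
qed

section \<open>The extremal problem\<close>

text \<open>
  The estimate does not degenerate at \<open>|c\<^sub>1| = 1\<close> because the allowance \<open>4|b|\<close> for \<open>|K|\<close> splits
  into \<open>|b|\<close>, paid for by the drop of \<open>|c\<^sub>2|\<close>, and \<open>3|b|\<close>, paid for by \<open>6|s| = 3|b c\<^sub>1|\<close>.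
\<close>

lemma coeff_difference_bound:
  fixes b c1 c2 K t s :: complex
  assumes K: "cmod K \<le> 4 * cmod b"
    and c1: "cmod c1 \<le> 1" and c2: "cmod c2 \<le> 1 - (cmod c1)\<^sup>2"
    and t: "6 * t = b * c2 + K * c1\<^sup>2" and s: "2 * s = b * c1"
  shows "cmod t - cmod s \<le> cmod b / 6"
proof -
  define x where "x = cmod c1"
  have x: "0 \<le> x" "x \<le> 1"
    using c1 by (simp_all add: x_def)
  have "6 * cmod t = cmod (b * c2 + K * c1\<^sup>2)"
    by (simp flip: t add: norm_mult)
  also have "\<dots> \<le> cmod b * cmod c2 + cmod K * x\<^sup>2"
    by (rule order.trans[OF norm_triangle_ineq]) (simp add: norm_mult norm_power x_def)
  also have "\<dots> \<le> cmod b * (1 - x\<^sup>2) + (4 * cmod b) * x\<^sup>2"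
    using c2 K by (intro add_mono mult_left_mono mult_right_mono) (auto simp: x_def)
  finally have 1: "6 * cmod t \<le> cmod b + 3 * (cmod b * x\<^sup>2)"
    by (simp add: algebra_simps)
  have 2: "2 * cmod s = cmod b * x"
    using arg_cong[OF s, of cmod] by (simp add: norm_mult x_def)
  have "cmod b * x\<^sup>2 \<le> cmod b * x"
    using x by (intro mult_left_mono) (simp_all add: power2_eq_square mult_left_le)
  with 1 2 show ?thesis
    by simp
qed

theorem mainTheorem3:
  fixes \<Phi> :: "complex \<Rightarrow> complex" and B :: "nat \<Rightarrow> complex"
  assumes "\<Phi> holomorphic_on unit_disc"
    and "inj_on \<Phi> unit_disc"
    and "\<And>n. B n = taylor_coeff \<Phi> n"
    and "\<Phi> 0 = 1"
    and "cnj ` (\<Phi> ` unit_disc) = \<Phi> ` unit_disc"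
    and "\<And>w. w \<in> \<Phi> ` unit_disc \<Longrightarrow> closed_segment 1 w \<subseteq> \<Phi> ` unit_disc"
    and "deriv \<Phi> 0 \<in> \<real>" and "Re (deriv \<Phi> 0) > 0"
    and "4 * Re (B 1) > max (cmod ((B 1)\<^sup>2 + B 2)) (cmod (2 * (B 1)\<^sup>2 - B 2))"
  shows "\<exists>M.
    is_maximum M
      ((\<lambda>f. cmod (taylor_coeff f 3) - cmod (taylor_coeff f 2)) ` ma_minda_convex \<Phi>) \<and>
    is_maximum M
      ((\<lambda>f. cmod (taylor_coeff (local_inverse f) 3) - cmod (taylor_coeff (local_inverse f) 2))
         ` ma_minda_convex \<Phi>)"
proof -
  note B = assms(3)
  have "Re (B 1) \<le> cmod (B 1)"
    by (rule complex_Re_le_cmod)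
  with assms(9) have K: "cmod ((B 1)\<^sup>2 + B 2) \<le> 4 * cmod (B 1)"
      "cmod (2 * (B 1)\<^sup>2 - B 2) \<le> 4 * cmod (B 1)"
    by simp_all
  \<comment> \<open>The sign of \<open>A\<^sub>3\<close> is reversed so that \<open>c\<^sub>2\<close> has coefficient \<open>B\<^sub>1\<close> in both problems.\<close>
  have coeffs: "2 * taylor_coeff f 2 = B 1 * taylor_coeff \<omega> 1"
      "6 * taylor_coeff f 3 = B 1 * taylor_coeff \<omega> 2 + ((B 1)\<^sup>2 + B 2) * (taylor_coeff \<omega> 1)\<^sup>2"
      "6 * - taylor_coeff (local_inverse f) 3 =
         B 1 * taylor_coeff \<omega> 2 + - (2 * (B 1)\<^sup>2 - B 2) * (taylor_coeff \<omega> 1)\<^sup>2"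
      "cmod (taylor_coeff (local_inverse f) 2) = cmod (taylor_coeff f 2)"
    if f: "f \<in> ma_minda_convex \<Phi>" and \<omega>: "\<omega> holomorphic_on unit_disc" "\<omega> 0 = 0"
      and eq: "\<forall>z\<in>unit_disc. 1 + z * deriv (deriv f) z / deriv f z = \<Phi> (\<omega> z)"
    for f \<omega>
  proof -
    have fA: "f \<in> class_A" and nz: "\<forall>z\<in>unit_disc. deriv f z \<noteq> 0"
      using f by (auto simp: ma_minda_convex_def)
    note cs = ma_minda_convex_coeffs[OF fA nz assms(1,4) \<omega> eq, folded B]
    show a2: "2 * taylor_coeff f 2 = B 1 * taylor_coeff \<omega> 1"
      and a3: "6 * taylor_coeff f 3
        = B 1 * taylor_coeff \<omega> 2 + ((B 1)\<^sup>2 + B 2) * (taylor_coeff \<omega> 1)\<^sup>2"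
      using cs by simp_all
    have "6 * - taylor_coeff (local_inverse f) 3
        = 6 * taylor_coeff f 3 - 3 * (2 * taylor_coeff f 2)\<^sup>2"
      unfolding local_inverse_coeffs(2)[OF fA] by (simp add: power_mult_distrib algebra_simps)
    also have "\<dots> = B 1 * taylor_coeff \<omega> 2 + - (2 * (B 1)\<^sup>2 - B 2) * (taylor_coeff \<omega> 1)\<^sup>2"
      unfolding a2 a3 by (simp add: power_mult_distrib algebra_simps)
    finally show "6 * - taylor_coeff (local_inverse f) 3
        = B 1 * taylor_coeff \<omega> 2 + - (2 * (B 1)\<^sup>2 - B 2) * (taylor_coeff \<omega> 1)\<^sup>2" .
    show "cmod (taylor_coeff (local_inverse f) 2) = cmod (taylor_coeff f 2)"
      unfolding local_inverse_coeffs(1)[OF fA] by simp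
  qed
  have upper: "cmod (taylor_coeff f 3) - cmod (taylor_coeff f 2) \<le> cmod (B 1) / 6"
      "cmod (taylor_coeff (local_inverse f) 3) - cmod (taylor_coeff (local_inverse f) 2)
         \<le> cmod (B 1) / 6"
    if f: "f \<in> ma_minda_convex \<Phi>" for f
  proof -
    from f obtain \<omega> where \<omega>: "\<omega> holomorphic_on unit_disc" "\<omega> ` unit_disc \<subseteq> unit_disc" "\<omega> 0 = 0"
      and eq: "\<forall>z\<in>unit_disc. 1 + z * deriv (deriv f) z / deriv f z = \<Phi> (\<omega> z)"
      unfolding ma_minda_convex_def subordinate_def by blast
    note cs = coeffs[OF f \<omega>(1,3) eq]
    note bound = schwarz_function_coeff_bound[OF \<omega>]
    show "cmod (taylor_coeff f 3) - cmod (taylor_coeff f 2) \<le> cmod (B 1) / 6"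
      by (rule coeff_difference_bound[OF K(1) bound cs(2) cs(1)])
    have "cmod (- (2 * (B 1)\<^sup>2 - B 2)) \<le> 4 * cmod (B 1)"
      using K(2) by (simp only: norm_minus_cancel)
    from coeff_difference_bound[OF this bound cs(3) cs(1)]
    show "cmod (taylor_coeff (local_inverse f) 3) - cmod (taylor_coeff (local_inverse f) 2)
        \<le> cmod (B 1) / 6"
      by (simp only: cs(4) norm_minus_cancel)
  qed
  define \<sigma> :: "complex \<Rightarrow> complex" where "\<sigma> = (\<lambda>z. z\<^sup>2)"
  have \<sigma>: "\<sigma> holomorphic_on unit_disc" "\<sigma> ` unit_disc \<subseteq> unit_disc" "\<sigma> 0 = 0"
    unfolding \<sigma>_def by (auto intro!: holomorphic_intros simp: norm_power power_less_one_iff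
        abs_square_less_1)
  have "fps_expansion \<sigma> 0 = fps_X\<^sup>2"
    unfolding \<sigma>_def by (rule fps_expansion_eqI[OF has_fps_expansion_fps_X_power])
  hence c: "taylor_coeff \<sigma> 1 = 0" "taylor_coeff \<sigma> 2 = 1"
    by (simp_all add: fps_X_power_nth)
  obtain f where f: "f \<in> ma_minda_convex \<Phi>"
    and eq: "\<forall>z\<in>unit_disc. 1 + z * deriv (deriv f) z / deriv f z = \<Phi> (\<sigma> z)"
    using ma_minda_convex_exists[OF assms(1,4) \<sigma>] by blast
  note cs = coeffs[OF f \<sigma>(1,3) eq, unfolded c]
  have a2: "cmod (taylor_coeff f 2) = 0"
    using cs(1) by simp
  have "cmod (6 * taylor_coeff f 3) = cmod (B 1)"
    using arg_cong[OF cs(2), of cmod] by simp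
  hence a3: "cmod (taylor_coeff f 3) = cmod (B 1) / 6"
    by (simp add: norm_mult)
  have "cmod (6 * - taylor_coeff (local_inverse f) 3) = cmod (B 1)"
    using arg_cong[OF cs(3), of cmod] by simp
  hence A3: "cmod (taylor_coeff (local_inverse f) 3) = cmod (B 1) / 6"
    by (simp add: norm_mult)
  have attained: "cmod (B 1) / 6 = cmod (taylor_coeff f 3) - cmod (taylor_coeff f 2)"
      "cmod (B 1) / 6
         = cmod (taylor_coeff (local_inverse f) 3) - cmod (taylor_coeff (local_inverse f) 2)"
    unfolding cs(4) a2 a3 A3 by simp_all
  show ?thesis
    unfolding is_maximum_def
  proof (intro exI[of _ "cmod (B 1) / 6"] conjI)
    show "cmod (B 1) / 6
        \<in> (\<lambda>f. cmod (taylor_coeff f 3) - cmod (taylor_coeff f 2)) ` ma_minda_convex \<Phi>"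
      using attained(1) f by (rule image_eqI)
    show "cmod (B 1) / 6
        \<in> (\<lambda>f. cmod (taylor_coeff (local_inverse f) 3) - cmod (taylor_coeff (local_inverse f) 2))
            ` ma_minda_convex \<Phi>"
      using attained(2) f by (rule image_eqI)
  qed (use upper in auto)
qed

end
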